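(* For every integer $n\ge 0$ and every prime $p\ge 3$: (i) $b_{4,7}\big(14(7n+j)+13\big)\equiv 0\pmod 2$ for $j\in\{1,2,3,4,5,6\}$. (ii) $b_{4,7}\!\left(98p^2n+\dfrac{98p^2+6}{8}\right)\equiv b_{4,7}(98n+13)\pmod 2$. (iii) $b_{4,7}\!\left(98p^2n+\dfrac{49p(p+8j)+3}{4}\right)\equiv 0\pmod 2$ for $j\in\{1,\dots,p-1\}$.
   Context: For $|q|<1$ and a positive integer $i$, $f_i := (q^i;q^i)_\infty = \prod_{m=1}^{\infty}(1-q^{im})$. For coprime positive integers $\ell,k$, a partition is called $(\ell,k)$-regular if none of its parts is divisible by $\ell$ or by $k$; $b_{\ell,k}(n)$ denotes the number of $(\ell,k)$-regular partitions of $n$, with $b_{\ell,k}(0)=1$. Equivalently, $\sum_{n=0}^{\infty} b_{\ell,k}(n)q^n = \dfrac{f_\ell f_k}{f_1 f_{\ell k}}$. *)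

theory Defs
  imports "HOL-Library.Multiset" "HOL-Number_Theory.Cong" "HOL-Computational_Algebra.Primes"
begin

(* A partition of n is encoded as the multiset of its parts. *)
definition partitions :: "nat \<Rightarrow> nat multiset set" where
  "partitions n = {P. (\<forall>x \<in># P. 0 < x) \<and> sum_mset P = n}"

definition regular_partitions :: "nat \<Rightarrow> nat \<Rightarrow> nat \<Rightarrow> nat multiset set" where
  "regular_partitions l k n = {P \<in> partitions n. \<forall>x \<in># P. \<not> l dvd x \<and> \<not> k dvd x}"

(* Intended for coprime positive l and k, although the definition makes sense without that. *)
definition b_reg :: "nat \<Rightarrow> nat \<Rightarrow> nat \<Rightarrow> nat" where
  "b_reg l k n = card (regular_partitions l k n)"

lemma finite_partitions: "finite (partitions n)"
proof -
  have bounded: "P \<in> mset ` {xs. set xs \<subseteq> {..n} \<and> length xs \<le> n}" if P: "P \<in> partitions n" for P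
  proof -
    obtain xs where xs: "P = mset xs" by (metis ex_mset)
    have pos: "\<forall>x \<in> set xs. 0 < x" and sum: "sum_list xs = n"
      using P by (auto simp: partitions_def xs sum_mset_sum_list)
    have "length xs \<le> sum_list xs"
      using pos by (induction xs) auto
    moreover have "set xs \<subseteq> {..n}"
      using member_le_sum_list sum by auto
    ultimately show ?thesis using xs sum by auto
  qed
  show ?thesis
    by (rule finite_subset[of _ "mset ` {xs. set xs \<subseteq> {..n} \<and> length xs \<le> n}"])
      (use bounded in \<open>auto intro: finite_lists_length_le\<close>)
qed

lemma finite_regular_partitions: "finite (regular_partitions l k n)"
  by (rule finite_subset[OF _ finite_partitions[of n]]) (auto simp: regular_partitions_def)

lemma b_reg_0: "b_reg l k 0 = 1"
proof -
  have "regular_partitions l k 0 = {{#}}"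
    by (auto simp: regular_partitions_def partitions_def)
      (metis multiset_nonemptyE less_irrefl)
  then show ?thesis by (simp add: b_reg_def)
qed

(* For odd p the two natural-number divisions below are exact. *)
lemma eight_dvd:
  fixes p :: nat
  assumes "odd p"
  shows "8 dvd 98 * p\<^sup>2 + 6"
proof -
  obtain m where "p = 2 * m + 1" using assms oddE by blast
  moreover have "even (m * (m + 1))" by simp
  then obtain c where "m * (m + 1) = 2 * c" by blast
  ultimately have "98 * p\<^sup>2 + 6 = 8 * (98 * c + 13)"
    by (simp add: power2_eq_square algebra_simps)
  then show ?thesis by simp
qed

lemma four_dvd:
  fixes p j :: nat
  assumes "odd p"
  shows "4 dvd 49 * p * (p + 8 * j) + 3"
proof -
  obtain m where "p = 2 * m + 1" using assms oddE by blast
  then have "49 * p * (p + 8 * j) + 3 = 4 * (49 * m * m + 49 * m + 13 + 98 * p * j)"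
    by (simp add: algebra_simps)
  then show ?thesis by simp
qed

end

theory Submission
  imports Defs "HOL-Library.Z2" "HOL-Computational_Algebra.Formal_Power_Series"
begin

text \<open>
  Modulo 2 the generating function of \<open>b_reg 4 7\<close> is \<open>f\<^sub>1\<^sup>3 / f\<^sub>7\<^sup>3\<close>, because squaring is additive.
  Gauss' identity \<open>f\<^sub>2\<^sup>2 / f\<^sub>1 = \<psi>(q) = \<Sum>\<^sub>k q\<^bsup>k(k+1)/2\<^esup>\<close> turns this into \<open>\<psi>(q) / \<psi>(q\<^sup>7)\<close>.
  The exponents of \<open>\<psi>(q)\<close> that are 6 modulo 7 give \<open>q\<^sup>6 \<psi>(q\<^bsup>49\<^esup>)\<close>, so the coefficients at \<open>7n + 6\<close>
  have generating function \<open>\<psi>(q\<^sup>7) / \<psi>(q) \<equiv> \<psi>(q) \<psi>(q\<^sup>7) / \<psi>(q\<^sup>2)\<close>. The odd part of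
  \<open>\<psi>(q) \<psi>(q\<^sup>7)\<close> is \<open>q \<psi>(q\<^sup>2) \<psi>(q\<^bsup>14\<^esup>)\<close>, by multiplication with an element of norm 2 in the ring
  of integers of \<open>\<rat>(\<surd>-7)\<close>. Hence \<open>b_reg 4 7 (14 n + 13)\<close> is odd exactly if \<open>n\<close> is 7 times a
  triangular number, and \<open>m\<close> is triangular iff \<open>8 m + 1\<close> is a square.
\<close>

unbundle fps_syntax

section \<open>Generating functions of partitions with restricted parts\<close>

definition parts_in :: "nat set \<Rightarrow> nat \<Rightarrow> nat multiset set" where
  "parts_in S n = {P \<in> partitions n. set_mset P \<subseteq> S}"

text \<open>This is the product of 1 / (1 - q^s) over the positive s in \<open>S\<close>. Defining
  it by counting avoids infinite products.\<close>

definition parts_fps :: "nat set \<Rightarrow> 'a::idom fps" where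
  "parts_fps S = Abs_fps (\<lambda>n. of_nat (card (parts_in S n)))"

lemma finite_parts_in: "finite (parts_in S n)"
  by (rule finite_subset[OF _ finite_partitions[of n]]) (auto simp: parts_in_def)

lemma partitions_part_le: "P \<in> partitions n \<Longrightarrow> x \<in># P \<Longrightarrow> x \<le> n"
  by (auto simp: partitions_def dest: multi_member_split)

text \<open>Parts of a partition of n lie in {1..n}. Hence any coefficient identity for infinite
  sets of parts can be checked on finite truncations, where honest products are available.\<close>

lemma parts_in_cong: "S \<inter> {1..n} = T \<inter> {1..n} \<Longrightarrow> parts_in S n = parts_in T n"
proof -
  have "set_mset P \<subseteq> {1..n}" if "P \<in> partitions n" for P
    using that by (auto simp: partitions_part_le) (simp add: partitions_def Suc_le_eq)
  then show "S \<inter> {1..n} = T \<inter> {1..n} \<Longrightarrow> parts_in S n = parts_in T n"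
    unfolding parts_in_def by blast
qed

lemma parts_fps_nth_cong:
  "S \<inter> {1..n} = T \<inter> {1..n} \<Longrightarrow> parts_fps S $ n = parts_fps T $ n"
  by (drule parts_in_cong) (simp add: parts_fps_def)

lemma parts_fps_cong_pos: "S - {0} = T - {0} \<Longrightarrow> parts_fps S = parts_fps T"
proof -
  have "A \<inter> {1..n} = (A - {0}) \<inter> {1..n}" for A :: "nat set" and n by auto
  then show "S - {0} = T - {0} \<Longrightarrow> parts_fps S = parts_fps T"
    by (intro fps_ext parts_fps_nth_cong) metis
qed

lemma parts_fps_empty: "parts_fps {} = 1"
proof (rule fps_ext)
  fix n show "parts_fps {} $ n = (1::'a fps) $ n"
  proof (cases "n = 0")
    case True
    then have "parts_in {} n = {{#}}" by (auto simp: parts_in_def partitions_def)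
    then show ?thesis using True by (simp add: parts_fps_def)
  next
    case False
    then have "parts_in {} n = {}" by (auto simp: parts_in_def partitions_def)
    then show ?thesis using False by (simp add: parts_fps_def)
  qed
qed

text \<open>If \<open>s\<close> occurs, removing one copy leaves a partition of \<open>n - s\<close>
  in which \<open>s\<close> may occur again, so the second summand keeps
  \<open>insert s S\<close>.\<close>

lemma parts_in_insert:
  assumes "0 < s" "s \<notin> S"
  shows "parts_in (insert s S) n = parts_in S n \<union>
    (if s \<le> n then add_mset s ` parts_in (insert s S) (n - s) else {})" (is "?L = ?R")
proof
  show "?R \<subseteq> ?L" using assms by (auto simp: parts_in_def partitions_def)
  show "?L \<subseteq> ?R"
  proof
    fix P assume P: "P \<in> ?L"
    show "P \<in> ?R"
    proof (cases "s \<in># P")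
      case True
      then obtain Q where Q: "P = add_mset s Q" by (blast dest: multi_member_split)
      then have "s \<le> n" "Q \<in> parts_in (insert s S) (n - s)"
        using P by (auto simp: parts_in_def partitions_def)
      then show ?thesis using Q by auto
    next
      case False
      then show ?thesis using P by (auto simp: parts_in_def)
    qed
  qed
qed

lemma parts_fps_insert:
  assumes "0 < s" "s \<notin> S"
  shows "parts_fps (insert s S) * (1 - fps_X ^ s) = (parts_fps S :: 'a::idom fps)"
proof (rule fps_ext)
  fix n
  have "card (parts_in (insert s S) n) =
      card (parts_in S n) + (if s \<le> n then card (parts_in (insert s S) (n - s)) else 0)"
  proof (subst parts_in_insert[OF assms], subst card_Un_disjoint)
    show "parts_in S n \<inter> (if s \<le> n then add_mset s ` parts_in (insert s S) (n - s) else {}) = {}"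
      using assms by (auto simp: parts_in_def)
  qed (auto simp: finite_parts_in card_image inj_on_def)
  then show "(parts_fps (insert s S) * (1 - fps_X ^ s)) $ n = (parts_fps S :: 'a fps) $ n"
    by (simp add: parts_fps_def right_diff_distrib fps_X_power_mult_right_nth)
qed

lemma prod_parts_fps:
  assumes "finite S" "0 \<notin> S"
  shows "(\<Prod>s\<in>S. 1 - fps_X ^ s) * parts_fps S = (1 :: 'a::idom fps)"
  using assms
proof (induction S)
  case (insert s S)
  then have "(parts_fps (insert s S) :: 'a fps) * (1 - fps_X ^ s) = parts_fps S"
    by (intro parts_fps_insert) auto
  moreover have "(\<Prod>s\<in>S. 1 - fps_X ^ s) * parts_fps S = (1 :: 'a fps)"
    using insert by auto
  ultimately show ?case
    unfolding prod.insert[OF insert.hyps] by (metis mult.assoc mult.commute)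
qed (simp add: parts_fps_empty)

lemma parts_fps_nth_0: "parts_fps S $ 0 = 1"
proof -
  have "parts_fps S $ 0 = (parts_fps {} $ 0 :: 'a)" by (rule parts_fps_nth_cong) auto
  then show ?thesis by (simp add: parts_fps_empty)
qed

lemma parts_fps_neq_0: "(parts_fps S :: 'a::idom fps) \<noteq> 0"
proof
  assume "(parts_fps S :: 'a fps) = 0"
  then show False using parts_fps_nth_0[of S, where ?'a = 'a] by simp
qed

lemma mult_inverse_unique:
  fixes a b u :: "'a::comm_monoid_mult"
  assumes "u * a = 1" "u * b = 1"
  shows "a = b"
proof -
  have "a = u * b * a" using assms(2) by simp
  also have "\<dots> = u * a * b" by (simp only: mult_ac)
  finally show ?thesis using assms(1) by simp
qed

text \<open>For finite sets both sides are inverse to the same product. The general case follows by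
  truncation, since the coefficient at n of a product involves only coefficients up to n.\<close>

lemma parts_fps_Un:
  assumes "S \<inter> T = {}"
  shows "parts_fps (S \<union> T) = (parts_fps S * parts_fps T :: 'a::idom fps)"
proof (rule fps_ext)
  fix n
  let ?S = "S \<inter> {1..n}" and ?T = "T \<inter> {1..n}"
  let ?c = "\<lambda>S. \<Prod>s\<in>S. 1 - fps_X ^ s :: 'a fps"
  have "?c (?S \<union> ?T) = ?c ?S * ?c ?T"
    using assms by (intro prod.union_disjoint) auto
  moreover have "?c (?S \<union> ?T) * parts_fps (?S \<union> ?T) = 1"
    "?c ?S * parts_fps ?S = 1" "?c ?T * parts_fps ?T = 1"
    by (auto intro!: prod_parts_fps)
  moreover have "?c ?S * ?c ?T * (parts_fps ?S * parts_fps ?T)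
      = ?c ?S * parts_fps ?S * (?c ?T * parts_fps ?T)"
    by (simp only: mult_ac)
  ultimately have fin: "parts_fps (?S \<union> ?T) = parts_fps ?S * (parts_fps ?T :: 'a fps)"
    by (intro mult_inverse_unique[of "?c (?S \<union> ?T)" "parts_fps (?S \<union> ?T)"]) (simp_all only: mult_1)
  have "parts_fps (S \<union> T) $ n = (parts_fps (?S \<union> ?T) $ n :: 'a)"
    by (rule parts_fps_nth_cong) auto
  also have "\<dots> = (parts_fps S * parts_fps T) $ n"
    unfolding fin fps_mult_nth
    by (intro sum.cong refl arg_cong2[of _ _ _ _ "(*)"] parts_fps_nth_cong) auto
  finally show "parts_fps (S \<union> T) $ n = (parts_fps S * parts_fps T :: 'a fps) $ n" .
qed

lemma one_minus_X_power_compose: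
  assumes "0 < k"
  shows "(1 - fps_X ^ s :: 'a::idom fps) oo fps_X ^ k = 1 - fps_X ^ (k * s)"
  using assms by (simp add: fps_compose_sub_distrib fps_X_power_compose power_mult)

lemma parts_fps_dilate:
  assumes "0 < k"
  shows "parts_fps ((*) k ` S) = (parts_fps S :: 'a::idom fps) oo fps_X ^ k"
proof (rule fps_ext)
  fix n
  let ?S = "S \<inter> {1..n}"
  have X0: "(fps_X ^ k :: 'a fps) $ 0 = 0" using assms by simp
  have "((\<Prod>s\<in>?S. 1 - fps_X ^ s) * parts_fps ?S) oo fps_X ^ k = (1 :: 'a fps) oo fps_X ^ k"
    by (subst prod_parts_fps) auto
  then have "(\<Prod>s\<in>?S. 1 - fps_X ^ (k * s)) * (parts_fps ?S oo fps_X ^ k) = (1 :: 'a fps)"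
    by (simp only: fps_compose_mult_distrib[OF X0] fps_compose_prod_distrib[OF X0]
        one_minus_X_power_compose[OF assms] fps_compose_1)
  moreover have "(\<Prod>s\<in>(*) k ` ?S. 1 - fps_X ^ s) * parts_fps ((*) k ` ?S) = (1 :: 'a fps)"
    using assms by (intro prod_parts_fps) auto
  then have "(\<Prod>s\<in>?S. 1 - fps_X ^ (k * s)) * parts_fps ((*) k ` ?S) = (1 :: 'a fps)"
    using assms by (subst (asm) prod.reindex) (auto intro!: inj_onI)
  ultimately have fin: "parts_fps ((*) k ` ?S) = (parts_fps ?S :: 'a fps) oo fps_X ^ k"
    by (rule mult_inverse_unique[rotated])
  have "parts_fps ((*) k ` S) $ n = (parts_fps ((*) k ` ?S) $ n :: 'a)"
  proof (rule parts_fps_nth_cong)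
    have "x \<le> n" "0 < x" if "k * x \<le> n" "Suc 0 \<le> k * x" for x
      using that assms by (auto intro: order_trans[of x "k * x"] intro!: Nat.gr0I)
    then show "(*) k ` S \<inter> {1..n} = (*) k ` ?S \<inter> {1..n}" by fastforce
  qed
  also have "\<dots> = (parts_fps S oo fps_X ^ k) $ n"
    unfolding fin fps_compose_nth
    by (intro sum.cong refl arg_cong2[of _ _ _ _ "(*)"] parts_fps_nth_cong) auto
  finally show "parts_fps ((*) k ` S) $ n = ((parts_fps S :: 'a fps) oo fps_X ^ k) $ n" .
qed

section \<open>Squaring in characteristic 2\<close>

lemma bit_fps_add_self: "f + f = (0 :: bit fps)"
  by (rule fps_ext) (metis fps_add_nth fps_zero_nth mult_2 bit_2_eq_0 mult_zero_left)

lemma one_minus_square_bit_fps: "(1 - f)\<^sup>2 = 1 - (f\<^sup>2 :: bit fps)"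
proof -
  have "(1 - f)\<^sup>2 - (1 - f\<^sup>2) = (f\<^sup>2 + f\<^sup>2) - (f + f)" by algebra
  then show ?thesis by (simp only: bit_fps_add_self diff_self right_minus_eq)
qed

text \<open>Over \<open>bit\<close> the factors satisfy (1 - q^s)^2 = 1 - q^(2s), so doubling all
  parts squares the finite products and hence their inverses.\<close>

lemma parts_fps_double: "parts_fps ((*) 2 ` S) = (parts_fps S :: bit fps)\<^sup>2"
proof (rule fps_ext)
  fix n
  let ?S = "S \<inter> {1..n}"
  have "(\<Prod>s\<in>?S. 1 - fps_X ^ s) * parts_fps ?S = (1 :: bit fps)"
    by (rule prod_parts_fps) auto
  moreover have "(\<Prod>s\<in>(*) 2 ` ?S. 1 - fps_X ^ s) * parts_fps ((*) 2 ` ?S) = (1 :: bit fps)"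
    by (intro prod_parts_fps) auto
  then have "(\<Prod>s\<in>?S. 1 - fps_X ^ (2 * s)) * parts_fps ((*) 2 ` ?S) = (1 :: bit fps)"
    by (subst (asm) prod.reindex) (auto intro!: inj_onI)
  moreover have "(\<Prod>s\<in>?S. 1 - fps_X ^ (2 * s)) = (\<Prod>s\<in>?S. 1 - fps_X ^ s :: bit fps)\<^sup>2"
    unfolding prod_power_distrib one_minus_square_bit_fps by (simp add: mult.commute flip: power_mult)
  moreover have "(\<Prod>s\<in>?S. 1 - fps_X ^ s)\<^sup>2 * (parts_fps ?S)\<^sup>2
      = ((\<Prod>s\<in>?S. 1 - fps_X ^ s) * parts_fps ?S :: bit fps)\<^sup>2"
    by (simp only: power_mult_distrib)
  ultimately have fin: "parts_fps ((*) 2 ` ?S) = (parts_fps ?S :: bit fps)\<^sup>2"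
    by (intro mult_inverse_unique[of "(\<Prod>s\<in>?S. 1 - fps_X ^ s)\<^sup>2" "parts_fps ((*) 2 ` ?S)"])
      (simp_all only: power_one)
  have "parts_fps ((*) 2 ` S) $ n = (parts_fps ((*) 2 ` ?S) $ n :: bit)"
    by (rule parts_fps_nth_cong) fastforce
  also have "\<dots> = ((parts_fps S)\<^sup>2) $ n"
    unfolding fin power2_eq_square fps_mult_nth
    by (intro sum.cong refl arg_cong2[of _ _ _ _ "(*)"] parts_fps_nth_cong) auto
  finally show "parts_fps ((*) 2 ` S) $ n = ((parts_fps S :: bit fps)\<^sup>2) $ n" .
qed

section \<open>Triangular numbers and Gauss' identity\<close>

definition tri :: "nat \<Rightarrow> nat" where
  "tri k = k * (k + 1) div 2"

lemma tri_Suc: "tri (Suc k) = tri k + Suc k"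
proof -
  have "Suc k * (Suc k + 1) = k * (k + 1) + Suc k * 2" by simp
  then show ?thesis by (simp only: tri_def) simp
qed

lemma tri_0 [simp]: "tri 0 = 0"
  by (simp add: tri_def)

lemma tri_ge: "k \<le> tri k"
  by (induction k) (auto simp: tri_Suc)

lemma strict_mono_tri: "strict_mono tri"
  by (auto simp: strict_mono_Suc_iff tri_Suc)

lemma eight_tri: "8 * tri k + 1 = (2 * k + 1)\<^sup>2"
  by (induction k) (auto simp: tri_Suc power2_eq_square)

lemma tri_double: "tri (2 * n) = n * (2 * n + 1)"
  by (simp add: tri_def)

lemma in_range_tri_iff: "n \<in> range tri \<longleftrightarrow> (\<exists>x. 8 * n + 1 = x\<^sup>2)"
proof
  assume "\<exists>x. 8 * n + 1 = x\<^sup>2"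
  then obtain x where x: "8 * n + 1 = x\<^sup>2" ..
  then have "odd (x\<^sup>2)" by presburger
  then have "odd x" by simp
  then obtain k where "x = 2 * k + 1" by (rule oddE)
  then have "n = tri k" using x eight_tri[of k] by simp
  then show "n \<in> range tri" by simp
qed (metis eight_tri rangeE)

text \<open>D. Shanks' finite form of Gauss' identity for the triangular numbers, with denominators
  cleared. As \<open>n\<close> grows only the summand \<open>s = 0\<close> on the left survives \<open>q\<close>-adically.\<close>

lemma Shanks_finite_identity:
  fixes q :: "'a::comm_ring_1"
  shows "(\<Sum>s<n. (\<Prod>i=s..<n. 1 - q ^ (2 * i + 2)) * (\<Prod>i<s. 1 - q ^ (2 * i + 1)) * q ^ (s * (2 * n + 1)))
    = (\<Prod>i<n. 1 - q ^ (2 * i + 1)) * (\<Sum>k<2 * n. q ^ tri k)"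
proof (induction n)
  case (Suc n)
  define e where "e m s = (\<Prod>i=s..<m. 1 - q ^ (2 * i + 2))" for m s
  define d where "d s = (\<Prod>i<s. 1 - q ^ (2 * i + 1))" for s
  \<comment> \<open>\<open>U\<close> is a telescoping certificate: passing from n to n + 1
    multiplies each summand by 1 - q^(2n+1), up to the difference
    \<open>U (Suc s) - U s\<close>.\<close>
  define U where "U s = e n s * d s * (1 - q ^ (2 * s)) * q ^ (s * (2 * n + 1))" for s
  have step: "e (Suc n) s * d s * q ^ (s * (2 * Suc n + 1))
      = (1 - q ^ (2 * n + 1)) * (e n s * d s * q ^ (s * (2 * n + 1))) + (U (Suc s) - U s)"
    if "s < n" for s
  proof -
    have e1: "e (Suc n) s = e n s * (1 - q ^ (2 * n + 1) * q)"
      using that by (simp add: e_def mult.commute)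
    have e2: "e n s = (1 - (q ^ s)\<^sup>2 * q * q) * e n (Suc s)"
      unfolding e_def prod.atLeast_Suc_lessThan[OF that] by (simp add: power_mult mult_ac)
    have d: "d (Suc s) = d s * (1 - (q ^ s)\<^sup>2 * q)"
      by (simp add: d_def power_mult mult_ac)
    have p1: "q ^ (s * (2 * Suc n + 1)) = q ^ (s * (2 * n + 1)) * (q ^ s)\<^sup>2"
      by (simp add: power2_eq_square flip: power_add)
    have p2: "q ^ (Suc s * (2 * n + 1)) = q ^ (s * (2 * n + 1)) * q ^ (2 * n + 1)"
      by (simp only: mult_Suc power_add mult.commute)
    have p3: "q ^ (2 * s) = (q ^ s)\<^sup>2" "q ^ (2 * Suc s) = (q ^ s)\<^sup>2 * q * q"
      by (simp_all add: power_mult mult_ac)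
    \<comment> \<open>The step as a polynomial identity, with Q = q^s, B = q^(2n+1), Z =
      q^(s(2n+1)), a = \<open>e n (Suc s)\<close> and c = \<open>d s\<close>.\<close>
    have ring: "(1 - Q\<^sup>2 * q * q) * a * (1 - B * q) * c * (Z * Q\<^sup>2)
        = (1 - B) * ((1 - Q\<^sup>2 * q * q) * a * c * Z)
          + (a * (c * (1 - Q\<^sup>2 * q)) * (1 - Q\<^sup>2 * q * q) * (Z * B)
            - (1 - Q\<^sup>2 * q * q) * a * c * (1 - Q\<^sup>2) * Z)" for a c Z Q B
      by (simp add: algebra_simps power2_eq_square)
    show ?thesis
      unfolding U_def e1 d p1 p2 p3 unfolding e2 by (rule ring)
  qed
  have "U 0 = 0" "U n = d n * (1 - q ^ (2 * n)) * q ^ (n * (2 * n + 1))"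
    by (simp_all add: U_def e_def)
  then have tel: "(\<Sum>s<n. U (Suc s) - U s) = d n * (1 - q ^ (2 * n)) * q ^ (n * (2 * n + 1))"
    by (simp add: sum_lessThan_telescope)
  have IH: "(\<Sum>s<n. e n s * d s * q ^ (s * (2 * n + 1))) = d n * (\<Sum>k<2 * n. q ^ tri k)"
    using Suc.IH by (simp add: e_def d_def)
  have e_last: "e (Suc n) n = 1 - q ^ (2 * n + 2)" by (simp add: e_def)
  have "(\<Sum>s<Suc n. e (Suc n) s * d s * q ^ (s * (2 * Suc n + 1)))
      = (\<Sum>s<n. (1 - q ^ (2 * n + 1)) * (e n s * d s * q ^ (s * (2 * n + 1))) + (U (Suc s) - U s))
        + (1 - q ^ (2 * n + 2)) * d n * q ^ (n * (2 * Suc n + 1))"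
    unfolding sum.lessThan_Suc e_last by (intro arg_cong2[of _ _ _ _ "(+)"] sum.cong refl step) simp
  also have "\<dots> = (1 - q ^ (2 * n + 1)) * (d n * (\<Sum>k<2 * n. q ^ tri k))
      + d n * (1 - q ^ (2 * n)) * q ^ (n * (2 * n + 1))
      + (1 - q ^ (2 * n + 2)) * d n * q ^ (n * (2 * Suc n + 1))"
    by (simp only: sum.distrib tel IH flip: sum_distrib_left)
  \<comment> \<open>The boundary term and the new summand s = n add up to \<open>d n\<close> *
    q^\<open>tri (2 * n)\<close> * (1 - q^(4n+2)). The last factor splits as (1 - q^(2n+1)) (1 +
    q^(2n+1)), which yields the two new triangular exponents.\<close>
  also have "\<dots> = d n * (1 - q ^ (2 * n + 1)) *
      ((\<Sum>k<2 * n. q ^ tri k) + q ^ tri (2 * n) + q ^ tri (2 * n + 1))"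
  proof -
    have "q ^ tri (2 * n) = q ^ (n * (2 * n + 1))"
      by (simp only: tri_double)
    moreover have "q ^ tri (2 * n + 1) = q ^ (n * (2 * n + 1)) * ((q ^ n)\<^sup>2 * q)"
    proof -
      have "tri (2 * n + 1) = n * (2 * n + 1) + (n * 2 + 1)"
        by (simp only: tri_Suc tri_double flip: Suc_eq_plus1)
      then show ?thesis by (simp only: power_add power_mult power_one_right)
    qed
    moreover have "q ^ (n * (2 * Suc n + 1)) = q ^ (n * (2 * n + 1)) * (q ^ n)\<^sup>2"
      by (simp add: power2_eq_square flip: power_add)
    moreover have "q ^ (2 * n) = (q ^ n)\<^sup>2" "q ^ (2 * n + 1) = (q ^ n)\<^sup>2 * q"
      "q ^ (2 * n + 2) = (q ^ n)\<^sup>2 * q * q"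
      by (simp_all add: power_mult mult_ac)
    moreover have "(1 - Q\<^sup>2 * q) * (c * S) + c * (1 - Q\<^sup>2) * Z + (1 - Q\<^sup>2 * q * q) * c * (Z * Q\<^sup>2)
        = c * (1 - Q\<^sup>2 * q) * (S + Z + Z * (Q\<^sup>2 * q))" for c S Z Q
      by (simp add: algebra_simps power2_eq_square)
    ultimately show ?thesis by (simp only:)
  qed
  also have "\<dots> = d (Suc n) * (\<Sum>k<2 * Suc n. q ^ tri k)"
    by (simp add: d_def add.assoc)
  finally show ?case by (simp only: e_def d_def)
qed simp

section \<open>Gauss' identity for power series\<close>

definition psi :: "'a::idom fps" where
  "psi = Abs_fps (\<lambda>n. of_bool (n \<in> range tri))"

lemma psi_nth: "psi $ n = of_bool (n \<in> range tri)"
  by (simp add: psi_def)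

text \<open>As \<open>tri\<close> is injective, no exponent is hit twice, and as k \<le>
  \<open>tri k\<close>, the omitted terms have exponents above n.\<close>

lemma sum_X_power_tri_nth:
  assumes "n < m"
  shows "(\<Sum>k<m. fps_X ^ tri k :: 'a::idom fps) $ n = psi $ n"
proof -
  have "(\<Sum>k<m. fps_X ^ tri k :: 'a fps) $ n = (\<Sum>k<m. of_bool (tri k = n))"
    by (simp add: fps_sum_nth fps_X_power_nth eq_commute of_bool_def)
  also have "\<dots> = psi $ n"
  proof (cases "n \<in> range tri")
    case True
    then obtain k where k: "n = tri k" by blast
    then have "k < m" using tri_ge[of k] assms by simp
    moreover have "tri i = n \<longleftrightarrow> i = k" for i
      using strict_mono_eq[OF strict_mono_tri] k by auto
    ultimately show ?thesis using True by (simp add: psi_nth of_bool_def)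
  next
    case False
    then have "tri i \<noteq> n" for i by auto
    then show ?thesis using False by (simp add: psi_nth)
  qed
  finally show ?thesis .
qed

text \<open>This is psi = f_2^2 / f_1, divided by f_2. Multiplying the finite identity for N = n + 1
  by the inverses of both finite products gives it up to terms divisible by q^N, which do not reach
  the coefficient at n.\<close>

lemma psi_even_odd_parts:
  "psi * parts_fps ((*) 2 ` {1..}) = (parts_fps {k. odd k} :: 'a::idom fps)"
proof (rule fps_ext)
  fix n
  define N where "N = Suc n"
  define Ev where "Ev = (\<lambda>i. 2 * i + 2) ` {..<N}"
  define Od where "Od = (\<lambda>i::nat. 2 * i + 1) ` {..<N}"
  let ?e = "parts_fps Ev :: 'a fps" and ?o = "parts_fps Od :: 'a fps"
  define t :: "nat \<Rightarrow> 'a fps" where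
    "t s = (\<Prod>i=s..<N. 1 - fps_X ^ (2 * i + 2)) * (\<Prod>i<s. 1 - fps_X ^ (2 * i + 1))" for s
  have "(\<Prod>s\<in>Ev. 1 - fps_X ^ s) * ?e = 1"
    by (rule prod_parts_fps) (auto simp: Ev_def)
  moreover have "(\<Prod>s\<in>Ev. 1 - fps_X ^ s :: 'a fps) = (\<Prod>i<N. 1 - fps_X ^ (2 * i + 2))"
    unfolding Ev_def by (subst prod.reindex) (auto intro!: inj_onI)
  ultimately have ce: "(\<Prod>i<N. 1 - fps_X ^ (2 * i + 2)) * ?e = 1" by (simp only:)
  have "(\<Prod>s\<in>Od. 1 - fps_X ^ s) * ?o = 1"
    by (rule prod_parts_fps) (auto simp: Od_def)
  moreover have "(\<Prod>s\<in>Od. 1 - fps_X ^ s :: 'a fps) = (\<Prod>i<N. 1 - fps_X ^ (2 * i + 1))"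
    unfolding Od_def by (subst prod.reindex) (auto intro!: inj_onI)
  ultimately have co: "(\<Prod>i<N. 1 - fps_X ^ (2 * i + 1)) * ?o = 1" by (simp only:)
  have "?e * (\<Sum>k<2 * N. fps_X ^ tri k) = ?e * ?o * (\<Sum>s<N. t s * fps_X ^ (s * (2 * N + 1)))"
  proof -
    have "?e * ?o * (c * d) = c * ?o * (?e * d)" for c d by (simp only: mult_ac)
    then show ?thesis unfolding t_def Shanks_finite_identity by (simp only: co mult_1)
  qed
  also have "(\<Sum>s<N. t s * fps_X ^ (s * (2 * N + 1))) =
      t 0 + (\<Sum>s<n. t (Suc s) * fps_X ^ (Suc s * (2 * N + 1)))"
  proof -
    have "{..<N} = {..<Suc n}" by (simp only: N_def)
    then show ?thesis by (simp only: sum.lessThan_Suc_shift) simp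
  qed
  \<comment> \<open>Every summand other than s = 0 carries an exponent of at least 2N + 1, so q^N
    can be pulled out.\<close>
  also have "(\<Sum>s<n. t (Suc s) * fps_X ^ (Suc s * (2 * N + 1))) =
      fps_X ^ N * (\<Sum>s<n. t (Suc s) * fps_X ^ (Suc s * (2 * N + 1) - N))"
    unfolding sum_distrib_left mult.left_commute[of "fps_X ^ N"]
    by (intro sum.cong refl) (simp flip: power_add)
  also have "?e * ?o * (t 0 + fps_X ^ N * (\<Sum>s<n. t (Suc s) * fps_X ^ (Suc s * (2 * N + 1) - N)))
      = ?o + fps_X ^ N * (?e * ?o * (\<Sum>s<n. t (Suc s) * fps_X ^ (Suc s * (2 * N + 1) - N)))"
    using ce by (simp add: t_def atLeast0LessThan algebra_simps)
  finally have "(?e * (\<Sum>k<2 * N. fps_X ^ tri k)) $ n = ?o $ n"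
    by (simp only: fps_add_nth fps_X_power_mult_nth) (simp add: N_def)
  moreover have "?o $ n = parts_fps {k. odd k} $ n"
  proof (rule parts_fps_nth_cong)
    show "Od \<inter> {1..n} = {k. odd k} \<inter> {1..n}"
      by (auto simp: Od_def N_def image_iff elim!: oddE)
  qed
  moreover have "?e $ i = parts_fps ((*) 2 ` {1..}) $ i" if "i \<le> n" for i
  proof (rule parts_fps_nth_cong)
    have "x \<in> Ev" if "x \<in> (*) 2 ` {1..}" "x \<le> n" for x
    proof -
      from that obtain y where "x = 2 * y" "1 \<le> y" by auto
      then show ?thesis using that by (auto simp: Ev_def N_def image_iff intro!: bexI[of _ "y - 1"])
    qed
    moreover have "x \<in> (*) 2 ` {1..}" if "x \<in> Ev" for x
      using that by (auto simp: Ev_def image_iff intro!: bexI[of _ "Suc _"])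
    ultimately show "Ev \<inter> {1..i} = (*) 2 ` {1..} \<inter> {1..i}" using \<open>i \<le> n\<close> by auto
  qed
  moreover have "(\<Sum>k<2 * N. fps_X ^ tri k :: 'a fps) $ (n - i) = psi $ (n - i)" for i
    by (rule sum_X_power_tri_nth) (simp add: N_def)
  ultimately show "(psi * parts_fps ((*) 2 ` {1..})) $ n = (parts_fps {k. odd k} :: 'a fps) $ n"
    by (simp add: fps_mult_nth mult.commute[of psi])
qed

text \<open>Let P = 1 / f_1, and let O be the series for odd parts. Separating even from odd parts
  gives P = P^2 O over \<open>bit\<close>, hence P O = 1; Gauss' identity reads psi P^2 = O. Thus
  psi is f_1^3 modulo 2.\<close>

lemma psi_times_cube:
  "psi * (parts_fps {1..}) ^ 3 = (1 :: bit fps)"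
proof -
  let ?P = "parts_fps {1..} :: bit fps" and ?O = "parts_fps {k. odd k} :: bit fps"
  have "{1..} = (*) 2 ` {1..} \<union> {k::nat. odd k}"
    by (auto simp: image_iff elim!: evenE) (metis One_nat_def Suc_leI mult_0_right neq0_conv odd_pos)+
  then have "?P = parts_fps ((*) 2 ` {1..} \<union> {k. odd k})" by simp
  also have "\<dots> = ?P\<^sup>2 * ?O"
    by (subst parts_fps_Un) (auto simp: parts_fps_double)
  finally have "?P * ?O = 1"
    using parts_fps_neq_0[of "{1..}", where ?'a = bit] by (simp add: power2_eq_square mult.assoc)
  moreover have "psi * ?P\<^sup>2 = ?O"
    using psi_even_odd_parts[where ?'a = bit] by (simp add: parts_fps_double)
  moreover have "psi * ?P ^ 3 = psi * ?P\<^sup>2 * ?P" by (simp add: eval_nat_numeral mult_ac)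
  ultimately show ?thesis by (simp add: mult.commute)
qed

lemma psi_neq_0: "psi \<noteq> (0 :: bit fps)"
  using psi_times_cube by force

text \<open>Both sides are inverse to P^6 for P = \<open>parts_fps {1..}\<close>: one by squaring
  psi P^3 = 1, the other by substituting q^2 for q, which turns P into P^2.\<close>

lemma psi_square: "psi\<^sup>2 = (psi :: bit fps) oo fps_X\<^sup>2"
proof -
  have X0: "(fps_X\<^sup>2 :: bit fps) $ 0 = 0" by simp
  have "(psi * (parts_fps {1..}) ^ 3) oo fps_X\<^sup>2 = (1 :: bit fps)"
    by (simp only: psi_times_cube fps_compose_1)
  then have "(psi oo fps_X\<^sup>2) * ((parts_fps {1..})\<^sup>2) ^ 3 = (1 :: bit fps)"
    by (simp only: fps_compose_mult_distrib[OF X0] fps_compose_power[OF X0, symmetric]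
        parts_fps_dilate[OF pos2, symmetric] parts_fps_double)
  moreover have "psi\<^sup>2 * ((parts_fps {1..})\<^sup>2) ^ 3 = (psi * (parts_fps {1..}) ^ 3 :: bit fps)\<^sup>2"
    by (simp add: power_mult_distrib flip: power_mult)
  ultimately show ?thesis
    by (intro mult_inverse_unique[of "((parts_fps {1..})\<^sup>2) ^ 3" "psi\<^sup>2"])
      (simp_all only: psi_times_cube power_one mult.commute)
qed

section \<open>Reduction of the generating function modulo 2\<close>

abbreviation psi7 :: "bit fps" where
  "psi7 \<equiv> psi oo fps_X ^ 7"

definition b47_fps :: "bit fps" where
  "b47_fps = Abs_fps (\<lambda>n. of_nat (b_reg 4 7 n))"

text \<open>With P = 1 / f_1 and Q = 1 / f_7 the claim amounts to Q^3 = \<open>b47_fps\<close> *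
  P^3, since psi and \<open>psi7\<close> are inverse to P^3 and Q^3.\<close>

lemma b47_psi7: "b47_fps * psi7 = psi"
proof -
  define M where "M k = (*) k ` {1::nat..}" for k
  define P :: "bit fps" where "P = parts_fps {1..}"
  define Q :: "bit fps" where "Q = parts_fps (M 7)"
  define R where "R = {x \<in> {1::nat..}. \<not> 4 dvd x \<and> \<not> 7 dvd x}"
  have M: "x \<in> M k \<longleftrightarrow> k dvd x \<and> 0 < x" if "0 < k" for x k
    using that by (auto simp: M_def image_iff Suc_le_eq elim!: dvdE)
  have quad: "parts_fps ((*) 4 ` S) = (parts_fps S :: bit fps) ^ 4" for S
  proof -
    have "(*) 4 ` S = (*) 2 ` (*) 2 ` S" by (auto simp: image_image)
    then show ?thesis by (simp only: parts_fps_double) (simp flip: power_mult)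
  qed
  have "regular_partitions 4 7 n = parts_in {x. \<not> 4 dvd x \<and> \<not> 7 dvd x} n" for n
    by (auto simp: regular_partitions_def parts_in_def)
  then have "b47_fps = parts_fps {x. \<not> 4 dvd x \<and> \<not> 7 dvd x}"
    by (simp only: b47_fps_def parts_fps_def b_reg_def)
  also have "\<dots> = parts_fps R"
    by (rule parts_fps_cong_pos) (auto simp: R_def Suc_le_eq intro!: Nat.gr0I)
  finally have B: "b47_fps = parts_fps R" .
  have M4: "parts_fps (M 4) = P ^ 4" by (simp only: quad P_def M_def)
  \<comment> \<open>A disjoint decomposition: regular parts, multiples of 4, and multiples of 7 that
    are not multiples of 28.\<close>
  have "{1..} = (R \<union> M 4) \<union> (M 7 - M 28)"
    using M by (auto simp: R_def) (presburger+)?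
  then have "P = parts_fps ((R \<union> M 4) \<union> (M 7 - M 28))" by (simp only: P_def)
  also have "\<dots> = b47_fps * P ^ 4 * parts_fps (M 7 - M 28)"
  proof (subst parts_fps_Un)
    show "(R \<union> M 4) \<inter> (M 7 - M 28) = {}"
      using M by (auto simp: R_def) presburger
    have "R \<inter> M 4 = {}" using M by (auto simp: R_def)
    then show "parts_fps (R \<union> M 4) * parts_fps (M 7 - M 28) = b47_fps * P ^ 4 * parts_fps (M 7 - M 28)"
      by (simp add: parts_fps_Un B M4)
  qed
  finally have 1: "P = b47_fps * P ^ 4 * parts_fps (M 7 - M 28)" .
  have "7 dvd x" if "28 dvd x" for x :: nat using that by presburger
  then have "M 7 = (M 7 - M 28) \<union> M 28" using M by auto
  then have "Q = parts_fps ((M 7 - M 28) \<union> M 28)" by (simp only: Q_def)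
  also have "\<dots> = parts_fps (M 7 - M 28) * parts_fps (M 28)"
    by (rule parts_fps_Un) auto
  also have "parts_fps (M 28) = parts_fps ((*) 4 ` M 7)" by (simp add: M_def image_image)
  also have "\<dots> = Q ^ 4" by (simp only: quad Q_def)
  finally have 2: "Q = parts_fps (M 7 - M 28) * Q ^ 4" .
  have "P \<noteq> 0" "Q \<noteq> 0" by (simp_all add: P_def Q_def parts_fps_neq_0)
  \<comment> \<open>Combining 1 and 2 eliminates the series for \<open>M 7 - M 28\<close>; what
    remains is cancelled by P Q.\<close>
  moreover have "P * Q ^ 4 = b47_fps * P ^ 4 * Q"
    using 1 2 by (metis mult.assoc)
  then have "P * Q * Q ^ 3 = P * Q * (b47_fps * P ^ 3)"
    by (simp add: eval_nat_numeral mult_ac)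
  ultimately have 3: "Q ^ 3 = b47_fps * P ^ 3" by simp
  have 4: "psi * P ^ 3 = 1" unfolding P_def by (rule psi_times_cube)
  then have "(psi * P ^ 3) oo fps_X ^ 7 = 1" by simp
  moreover have X0: "(fps_X ^ 7 :: bit fps) $ 0 = 0" by simp
  moreover have "P oo fps_X ^ 7 = Q"
    unfolding P_def Q_def M_def by (rule parts_fps_dilate[symmetric]) simp
  ultimately have "psi7 * Q ^ 3 = 1"
    by (simp only: fps_compose_mult_distrib[OF X0] fps_compose_power[OF X0, symmetric])
  then have "psi = b47_fps * psi7 * (psi * P ^ 3)"
    using 3 by (metis mult.assoc mult.commute mult_1)
  then show ?thesis using 4 by simp
qed

section \<open>Sections of power series\<close>

definition section_fps :: "nat \<Rightarrow> nat \<Rightarrow> 'a::idom fps \<Rightarrow> 'a fps" where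
  "section_fps k r f = Abs_fps (\<lambda>n. f $ (k * n + r))"

lemma section_fps_nth [simp]: "section_fps k r f $ n = f $ (k * n + r)"
  by (simp add: section_fps_def)

lemma fps_compose_X_power_nth:
  assumes "0 < k"
  shows "((f :: 'a::idom fps) oo fps_X ^ k) $ n = (if k dvd n then f $ (n div k) else 0)"
proof -
  have "(f oo fps_X ^ k) $ n = (\<Sum>i=0..n. if n = k * i then f $ i else 0)"
    by (simp add: fps_compose_nth fps_X_power_nth if_distrib cong: if_cong flip: power_mult)
  also have "\<dots> = (if k dvd n then f $ (n div k) else 0)"
  proof (cases "k dvd n")
    case True
    then have "n = k * i \<longleftrightarrow> i = n div k" for i using assms by auto
    then show ?thesis using True by simp
  qed (auto intro!: sum.neutral)
  finally show ?thesis .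
qed

text \<open>A series in q^k has exponents divisible by k only, so multiplying by it preserves
  residue classes of exponents. The bound r < k keeps the multiples of k up to k n + r within k
  n.\<close>

lemma section_fps_mult_compose:
  assumes "r < k"
  shows "section_fps k r (f * (g oo fps_X ^ k)) = section_fps k r f * (g :: 'a::idom fps)"
proof (rule fps_ext)
  fix n
  have "(f * (g oo fps_X ^ k)) $ (k * n + r)
      = (\<Sum>i=0..k * n + r. (g oo fps_X ^ k) $ i * f $ (k * n + r - i))"
    by (subst mult.commute) (simp add: fps_mult_nth)
  also have "\<dots> = (\<Sum>i\<in>(*) k ` {0..n}. (g oo fps_X ^ k) $ i * f $ (k * n + r - i))"
  proof (rule sum.mono_neutral_right)
    have "i \<le> n" if "k * i \<le> k * n + r" for i
    proof (rule ccontr)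
      assume "\<not> i \<le> n"
      then have "k * Suc n \<le> k * i" by (intro mult_le_mono) auto
      then show False using that assms by simp
    qed
    then show "\<forall>i\<in>{0..k * n + r} - (*) k ` {0..n}. (g oo fps_X ^ k) $ i * f $ (k * n + r - i) = 0"
      using assms by (auto simp: fps_compose_X_power_nth)
  qed (auto intro!: trans_le_add1 mult_le_mono)
  also have "\<dots> = (\<Sum>i=0..n. g $ i * f $ (k * (n - i) + r))"
    using assms by (subst sum.reindex)
      (auto intro!: inj_onI sum.cong simp: fps_compose_X_power_nth diff_mult_distrib2 add.commute)
  also have "\<dots> = (section_fps k r f * g) $ n"
    by (simp add: fps_mult_nth mult.commute[of "section_fps k r f"])
  finally show "section_fps k r (f * (g oo fps_X ^ k)) $ n = (section_fps k r f * g) $ n"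
    by simp
qed

text \<open>Since 8 (7n + 6) + 1 = 7 (8n + 7), a square of this form is (7y)^2 with 8n + 7 = 7 y^2.
  So 7 divides n, and 8 (n / 7) + 1 = y^2.\<close>

lemma section_7_6_psi: "section_fps 7 6 psi = psi7"
proof (rule fps_ext)
  fix n
  have "7 * n + 6 \<in> range tri \<longleftrightarrow> 7 dvd n \<and> n div 7 \<in> range tri"
  proof
    assume "7 * n + 6 \<in> range tri"
    then obtain x where x: "8 * (7 * n + 6) + 1 = x\<^sup>2"
      unfolding in_range_tri_iff by blast
    then have "x\<^sup>2 = 7 * (8 * n + 7)" by simp
    then have "7 dvd x\<^sup>2" by simp
    then have "7 dvd x" using prime_dvd_power[of 7 x 2] by simp
    then obtain y where y: "x = 7 * y" ..
    then have "8 * n + 7 = 7 * y\<^sup>2" using x by (simp add: power2_eq_square)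
    then have "7 dvd n" by presburger
    then obtain m where m: "n = 7 * m" ..
    then have "8 * m + 1 = y\<^sup>2" using \<open>8 * n + 7 = 7 * y\<^sup>2\<close> by simp
    then show "7 dvd n \<and> n div 7 \<in> range tri" using m in_range_tri_iff by auto
  next
    assume "7 dvd n \<and> n div 7 \<in> range tri"
    then obtain m x where "n = 7 * m" "8 * m + 1 = x\<^sup>2" by (auto simp: in_range_tri_iff)
    then have "8 * (7 * n + 6) + 1 = (7 * x)\<^sup>2" by (simp add: power_mult_distrib)
    then show "7 * n + 6 \<in> range tri" unfolding in_range_tri_iff by blast
  qed
  then show "section_fps 7 6 psi $ n = psi7 $ n"
    by (simp add: psi_nth fps_compose_X_power_nth)
qed

section \<open>Representations by \<open>x\<^sup>2 + 7 y\<^sup>2\<close>\<close>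

text \<open>Residue 1 modulo 4 picks exactly one of \<open>x\<close> and \<open>-x\<close> for odd \<open>x\<close>, which gives a
  parametrisation of the triangular numbers by \<open>(x\<^sup>2 - 1) / 8\<close>.\<close>

definition norm_pairs :: "nat \<Rightarrow> (int \<times> int) set" where
  "norm_pairs N = {(x, y). x mod 4 = 1 \<and> y mod 4 = 1 \<and> x\<^sup>2 + 7 * y\<^sup>2 = int N}"

lemma square_1_mod_4:
  fixes x :: int
  assumes "x mod 4 = 1"
  obtains k where "x\<^sup>2 = 8 * int (tri k) + 1"
proof -
  have "odd \<bar>x\<bar>" using assms by presburger
  then obtain k where "nat \<bar>x\<bar> = 2 * k + 1" by (metis even_nat_iff abs_ge_zero oddE)
  then have "\<bar>x\<bar> = int (2 * k + 1)" by simp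
  then have "x\<^sup>2 = int ((2 * k + 1)\<^sup>2)" by (metis power2_abs of_nat_power)
  then have "x\<^sup>2 = int (8 * tri k + 1)" by (simp only: eight_tri)
  then have "x\<^sup>2 = 8 * int (tri k) + 1" by simp
  then show thesis by (rule that)
qed

text \<open>The equation n = \<open>tri k\<close> + 7 \<open>tri l\<close> is equivalent to 8n + 8 =
  (2k + 1)^2 + 7 (2l + 1)^2, and the residue 1 modulo 4 fixes the signs of the two odd
  numbers.\<close>

lemma psi_psi7_nth: "(psi * psi7) $ n = of_nat (card (norm_pairs (8 * n + 8)))"
proof -
  define I where "I = {i \<in> {0..n}. i \<in> range tri \<and> 7 dvd n - i \<and> (n - i) div 7 \<in> range tri}"
  have "(psi * psi7) $ n = (\<Sum>i=0..n. of_bool (i \<in> I))"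
    unfolding fps_mult_nth
    by (intro sum.cong refl) (auto simp: psi_nth fps_compose_X_power_nth I_def)
  also have "\<dots> = of_nat (card I)"
  proof -
    have "{0..n} \<inter> {i. i \<in> I} = I" by (auto simp: I_def)
    then show ?thesis unfolding of_bool_def by (subst sum.If_cases) simp_all
  qed
  also have "card I = card (norm_pairs (8 * n + 8))"
  proof (rule bij_betw_same_card[symmetric])
    \<comment> \<open>This recovers \<open>tri k\<close> from x = \<plusminus>(2k + 1); the norm
      equation then determines y^2.\<close>
    define f :: "int \<times> int \<Rightarrow> nat" where "f = (\<lambda>(x, y). nat ((x\<^sup>2 - 1) div 8))"
    show "bij_betw f (norm_pairs (8 * n + 8)) I"
      unfolding bij_betw_def
    proof
      show "inj_on f (norm_pairs (8 * n + 8))"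
      proof (rule inj_onI, clarify)
        fix x y x' y' assume 1: "(x, y) \<in> norm_pairs (8 * n + 8)" "(x', y') \<in> norm_pairs (8 * n + 8)"
          and 2: "f (x, y) = f (x', y')"
        have eq: "u = v" if "u\<^sup>2 = v\<^sup>2" "u mod 4 = 1" "v mod 4 = 1" for u v :: int
        proof -
          have "u = v \<or> u = - v" using that(1) by (simp add: power2_eq_iff)
          then show ?thesis using that(2,3) by presburger
        qed
        obtain k where k: "x\<^sup>2 = 8 * int (tri k) + 1"
          using 1 square_1_mod_4[of x] by (auto simp: norm_pairs_def)
        obtain k' where k': "x'\<^sup>2 = 8 * int (tri k') + 1"
          using 1 square_1_mod_4[of x'] by (auto simp: norm_pairs_def)
        have "x\<^sup>2 = x'\<^sup>2" using 2 unfolding f_def by (simp add: k k')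
        moreover from this have "y\<^sup>2 = y'\<^sup>2" using 1 by (simp add: norm_pairs_def)
        moreover have "x mod 4 = 1" "y mod 4 = 1" "x' mod 4 = 1" "y' mod 4 = 1"
          using 1 by (simp_all add: norm_pairs_def)
        ultimately show "x = x' \<and> y = y'" by (blast intro: eq)
      qed
      have "f (x, y) \<in> I" if xy: "(x, y) \<in> norm_pairs (8 * n + 8)" for x y
      proof -
        obtain k where k: "x\<^sup>2 = 8 * int (tri k) + 1"
          using xy square_1_mod_4[of x] by (auto simp: norm_pairs_def)
        obtain l where l: "y\<^sup>2 = 8 * int (tri l) + 1"
          using xy square_1_mod_4[of y] by (auto simp: norm_pairs_def)
        have "n = tri k + 7 * tri l" using xy k l by (simp add: norm_pairs_def)
        then show ?thesis by (simp add: f_def k I_def)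
      qed
      moreover have "i \<in> f ` norm_pairs (8 * n + 8)" if "i \<in> I" for i
      proof -
        have sgn: "\<exists>x::int. x mod 4 = 1 \<and> x\<^sup>2 = 8 * int (tri k) + 1" for k
        proof -
          have "int (2 * k + 1) mod 4 = 1 \<or> (- int (2 * k + 1)) mod 4 = 1"
            by presburger
          moreover have "(int (2 * k + 1))\<^sup>2 = int (8 * tri k + 1)"
            by (simp only: eight_tri of_nat_power)
          then have "(int (2 * k + 1))\<^sup>2 = 8 * int (tri k) + 1" by simp
          ultimately show ?thesis by (metis power2_minus)
        qed
        from that obtain k m l where k: "i = tri k" "n - i = 7 * m" "m = tri l" "i \<le> n"
          by (auto simp: I_def)
        then have n: "n = tri k + 7 * tri l" by simp
        obtain x y where "x mod 4 = 1" "x\<^sup>2 = 8 * int (tri k) + 1"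
          "y mod 4 = 1" "y\<^sup>2 = 8 * int (tri l) + 1"
          using sgn by blast
        then have "(x, y) \<in> norm_pairs (8 * n + 8)" "f (x, y) = i"
          by (auto simp: norm_pairs_def f_def n k)
        then show ?thesis by blast
      qed
      ultimately show "f ` norm_pairs (8 * n + 8) = I" by auto
    qed
  qed
  finally show ?thesis .
qed

text \<open>Congruent odd numbers modulo 4 are normalised by a common sign. The disjunction mirrors
  the two branches of \<open>normal\<close> below.\<close>

lemma mod_4_sign:
  fixes a b :: int
  assumes "4 dvd a - b" "odd b"
  shows "(a mod 4 = 1 \<and> b mod 4 = 1) \<or> (a mod 4 \<noteq> 1 \<and> (- a) mod 4 = 1 \<and> (- b) mod 4 = 1)"
  using assms by presburger

text \<open>Multiplication by \<open>(1 + \<surd>-7) / 2\<close>, an element of norm 2, followed by a sign change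
  that restores the residues modulo 4.\<close>

lemma card_norm_pairs_double:
  "card (norm_pairs (16 * n + 16)) = card (norm_pairs (8 * n + 8))"
proof (rule bij_betw_same_card[symmetric])
  define normal :: "int \<times> int \<Rightarrow> int \<times> int" where
    "normal = (\<lambda>(x, y). if x mod 4 = 1 then (x, y) else (- x, - y))"
  define f :: "int \<times> int \<Rightarrow> int \<times> int" where
    "f = (\<lambda>(x, y). normal ((x - 7 * y) div 2, (x + y) div 2))"
  \<comment> \<open>Up to sign this divides by (1 + \<surd>-7) / 2, that is, multiplies by (1 -
    \<surd>-7) / 4.\<close>
  define g :: "int \<times> int \<Rightarrow> int \<times> int" where
    "g = (\<lambda>(x, y). normal ((x + 7 * y) div 4, (y - x) div 4))"
  have f: "f (x, y) \<in> norm_pairs (16 * n + 16) \<and> g (f (x, y)) = (x, y)"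
    if xy: "(x, y) \<in> norm_pairs (8 * n + 8)" for x y
  proof -
    have mods: "x mod 4 = 1" "y mod 4 = 1" and N: "x\<^sup>2 + 7 * y\<^sup>2 = 8 * int n + 8"
      using xy by (auto simp: norm_pairs_def)
    define a where "a = (x - 7 * y) div 2"
    define b where "b = (x + y) div 2"
    have ab: "x - 7 * y = 2 * a" "x + y = 2 * b" unfolding a_def b_def using mods by presburger+
    then have xa: "x = 2 * b - y" "a = b - 4 * y" by auto
    have "odd b" using mods ab(2) by presburger
    then have sgn: "(a mod 4 = 1 \<and> b mod 4 = 1) \<or> (a mod 4 \<noteq> 1 \<and> (- a) mod 4 = 1 \<and> (- b) mod 4 = 1)"
      using xa(2) by (intro mod_4_sign) simp_all
    have norm: "a\<^sup>2 + 7 * b\<^sup>2 = 16 * int n + 16"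
      using N unfolding xa by (simp add: power2_eq_square algebra_simps)
    have divs: "(a + 7 * b) div 4 = x" "(b - a) div 4 = y"
      "(- a + 7 * - b) div 4 = - x" "(- b - - a) div 4 = - y" using xa by auto
    \<comment> \<open>The sign that \<open>normal\<close> may introduce is undone by the second
      application of \<open>normal\<close>.\<close>
    have "(- x) mod 4 \<noteq> 1" using mods by presburger
    then have "normal (x, y) = (x, y)" "normal (- x, - y) = (x, y)"
      using mods by (simp_all add: normal_def)
    then have "g (a, b) = (x, y)" "g (- a, - b) = (x, y)"
      by (simp_all only: g_def case_prod_conv divs)
    moreover have "f (x, y) = normal (a, b)"
      by (simp only: f_def a_def b_def case_prod_conv)
    ultimately show ?thesis using norm sgn
      by (elim disjE conjE)
        (simp_all only: normal_def norm_pairs_def case_prod_conv mem_Collect_eq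
          if_True if_False simp_thms power2_minus of_nat_add of_nat_mult of_nat_numeral)
  qed
  have g: "g (x, y) \<in> norm_pairs (8 * n + 8) \<and> f (g (x, y)) = (x, y)"
    if xy: "(x, y) \<in> norm_pairs (16 * n + 16)" for x y
  proof -
    have mods: "x mod 4 = 1" "y mod 4 = 1" and N: "x\<^sup>2 + 7 * y\<^sup>2 = 16 * int n + 16"
      using xy by (auto simp: norm_pairs_def)
    define b where "b = (y - x) div 4"
    have yb: "y = x + 4 * b" unfolding b_def using mods by presburger
    define a where "a = (x + 7 * y) div 4"
    have xa: "a = 2 * x + 7 * b" unfolding a_def yb by simp
    \<comment> \<open>With y = x + 4b the norm becomes 8 (x^2 + 7xb + 14b^2). Divisibility by 16
      makes the bracket even, which forces b to be odd because x is.\<close>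
    have "8 * (x * x + 7 * (x * b) + 14 * (b * b)) = 8 * (2 * int n + 2)"
      using N unfolding yb by (simp add: power2_eq_square algebra_simps)
    then have N': "x * x + 7 * (x * b) + 14 * (b * b) = 2 * int n + 2" by simp
    then have "even (x * x + 7 * (x * b) + 14 * (b * b))" by simp
    moreover have "odd x" using mods by presburger
    ultimately have "odd b" by simp
    moreover have "4 dvd a - b" using \<open>odd x\<close> \<open>odd b\<close> xa by presburger
    ultimately have sgn: "(a mod 4 = 1 \<and> b mod 4 = 1) \<or> (a mod 4 \<noteq> 1 \<and> (- a) mod 4 = 1 \<and> (- b) mod 4 = 1)"
      by (intro mod_4_sign)
    have norm: "a\<^sup>2 + 7 * b\<^sup>2 = 8 * int n + 8"
      using N' unfolding xa by (simp add: power2_eq_square algebra_simps)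
    have divs: "(a - 7 * b) div 2 = x" "(a + b) div 2 = y"
      "(- a - 7 * - b) div 2 = - x" "(- a + - b) div 2 = - y" using xa yb by auto
    have "(- x) mod 4 \<noteq> 1" using mods by presburger
    then have "normal (x, y) = (x, y)" "normal (- x, - y) = (x, y)"
      using mods by (simp_all add: normal_def)
    then have "f (a, b) = (x, y)" "f (- a, - b) = (x, y)"
      by (simp_all only: f_def case_prod_conv divs)
    moreover have "g (x, y) = normal (a, b)"
      by (simp only: g_def a_def b_def case_prod_conv)
    ultimately show ?thesis using norm sgn
      by (elim disjE conjE)
        (simp_all only: normal_def norm_pairs_def case_prod_conv mem_Collect_eq
          if_True if_False simp_thms power2_minus of_nat_add of_nat_mult of_nat_numeral)
  qed
  show "bij_betw f (norm_pairs (8 * n + 8)) (norm_pairs (16 * n + 16))"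
    by (rule bij_betw_byWitness[of _ g]) (use f g in auto)
qed

lemma section_2_1_psi_psi7: "section_fps 2 1 (psi * psi7) = psi * psi7"
proof (rule fps_ext)
  fix n :: nat
  have "8 * (2 * n + 1) + 8 = 16 * n + 16" by simp
  then show "section_fps 2 1 (psi * psi7) $ n = (psi * psi7) $ n"
    by (simp only: section_fps_nth psi_psi7_nth card_norm_pairs_double)
qed

section \<open>Parity on the progression 14 n + 13\<close>

text \<open>The section C of \<open>b47_fps\<close> satisfies C psi = \<open>psi7\<close>, hence C
  psi^2 = psi \<open>psi7\<close>. Over \<open>bit\<close> psi^2 is a series in q^2, so it passes
  through the section modulo 2 and comes out as psi, which cancels.\<close>

lemma b47_section: "section_fps 2 1 (section_fps 7 6 b47_fps) = psi7"
proof -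
  let ?C = "section_fps 7 6 b47_fps"
  have C: "?C * psi = psi7"
    using section_fps_mult_compose[of 6 7 b47_fps psi] by (simp add: b47_psi7 section_7_6_psi)
  have "section_fps 2 1 ?C * psi = section_fps 2 1 (?C * psi\<^sup>2)"
    using section_fps_mult_compose[of 1 2 ?C psi] by (simp add: psi_square)
  also have "?C * psi\<^sup>2 = psi * psi7"
    using C by (metis mult.assoc mult.commute power2_eq_square)
  also have "section_fps 2 1 (psi * psi7) = psi7 * psi"
    unfolding section_2_1_psi_psi7 by (rule mult.commute)
  finally have "section_fps 2 1 ?C * psi = psi7 * psi" .
  then show ?thesis using psi_neq_0 by simp
qed

lemma of_nat_bit_eq_iff: "(of_nat m :: bit) = of_nat n \<longleftrightarrow> [m = n] (mod 2)"
proof -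
  have "(of_nat m :: bit) = of_bool (odd m)" for m by (induction m) auto
  then show ?thesis by (auto simp: cong_def mod2_eq_if of_bool_def)
qed

text \<open>The nested sections pick the exponents 7 (2n + 1) + 6 = 14n + 13.\<close>

lemma b47_parity: "[b_reg 4 7 (14 * n + 13) = of_bool (7 dvd n \<and> n div 7 \<in> range tri)] (mod 2)"
proof -
  have "of_nat (b_reg 4 7 (14 * n + 13)) = section_fps 2 1 (section_fps 7 6 b47_fps) $ n"
    by (simp add: b47_fps_def algebra_simps)
  also have "\<dots> = of_nat (of_bool (7 dvd n \<and> n div 7 \<in> range tri))"
    unfolding b47_section by (simp add: fps_compose_X_power_nth psi_nth)
  finally show ?thesis by (simp only: of_nat_bit_eq_iff)
qed

lemma b47_parity_98: "[b_reg 4 7 (98 * n + 13) = of_bool (n \<in> range tri)] (mod 2)"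
  using b47_parity[of "7 * n"] by simp

theorem theorem1p2:
  fixes n p :: nat
  assumes "prime p" and "p \<ge> 3"
  shows "(\<forall>j \<in> {1, 2, 3, 4, 5, 6}. [b_reg 4 7 (14 * (7 * n + j) + 13) = 0] (mod 2))
    \<and> [b_reg 4 7 (98 * p\<^sup>2 * n + (98 * p\<^sup>2 + 6) div 8) = b_reg 4 7 (98 * n + 13)] (mod 2)
    \<and> (\<forall>j \<in> {1..p - 1}. [b_reg 4 7 (98 * p\<^sup>2 * n + (49 * p * (p + 8 * j) + 3) div 4) = 0] (mod 2))"
proof (intro conjI ballI)
  fix j :: nat assume "j \<in> {1, 2, 3, 4, 5, 6}"
  moreover have "7 dvd 7 * n + j \<longleftrightarrow> 7 dvd j" by (rule dvd_add_right_iff) simp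
  ultimately have "\<not> 7 dvd 7 * n + j" by auto
  then show "[b_reg 4 7 (14 * (7 * n + j) + 13) = 0] (mod 2)"
    using b47_parity[of "7 * n + j"] by simp
next
  have "odd p" using assms prime_odd_nat by auto
  then obtain k where "p = 2 * k + 1" by (rule oddE)
  then have p2: "p\<^sup>2 = 8 * tri k + 1" by (simp only: eight_tri)
  \<comment> \<open>Chosen so that the argument in (ii) is 98m + 13. Then 8m + 1 is p^2 times 8n +
    1, and the two are squares simultaneously.\<close>
  define m where "m = p\<^sup>2 * n + tri k"
  have m: "8 * m + 1 = p\<^sup>2 * (8 * n + 1)"
    by (simp add: m_def algebra_simps p2)
  have "m \<in> range tri \<longleftrightarrow> n \<in> range tri"
  proof
    assume "m \<in> range tri"
    then obtain x where x: "p\<^sup>2 * (8 * n + 1) = x\<^sup>2" unfolding in_range_tri_iff m by blast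
    then have "p dvd x" by (metis dvd_triv_left pow_divides_pow_iff zero_less_numeral)
    then obtain y where "x = p * y" ..
    then have "p\<^sup>2 * (8 * n + 1) = p\<^sup>2 * y\<^sup>2" using x by (simp only: power_mult_distrib)
    then have "8 * n + 1 = y\<^sup>2" using assms by (subst (asm) mult_cancel_left) auto
    then show "n \<in> range tri" unfolding in_range_tri_iff by blast
  next
    assume "n \<in> range tri"
    then show "m \<in> range tri" unfolding in_range_tri_iff m by (metis power_mult_distrib)
  qed
  moreover have "98 * p\<^sup>2 * n + (98 * p\<^sup>2 + 6) div 8 = 98 * m + 13"
    by (simp add: m_def p2 algebra_simps)
  ultimately show "[b_reg 4 7 (98 * p\<^sup>2 * n + (98 * p\<^sup>2 + 6) div 8) = b_reg 4 7 (98 * n + 13)] (mod 2)"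
    using b47_parity_98[of m] b47_parity_98[of n] by (simp only: cong_def)
  fix j assume j: "j \<in> {1..p - 1}"
  \<comment> \<open>The argument in (iii) is 98 (m + pj) + 13. A square x^2 = 8 (m + pj) + 1 would
    be divisible by p and hence by p^2, so p would divide 8j, against p \<ge> 3 and 0 < j <
    p.\<close>
  have "m + p * j \<notin> range tri"
  proof
    assume "m + p * j \<in> range tri"
    then obtain x where "8 * (m + p * j) + 1 = x\<^sup>2" unfolding in_range_tri_iff by blast
    then have x: "p\<^sup>2 * (8 * n + 1) + p * (8 * j) = x\<^sup>2" using m by (simp add: algebra_simps)
    then have "p dvd x\<^sup>2" by (metis dvd_add dvd_triv_left dvd_mult2 power2_eq_square)
    then have "p dvd x" using assms prime_dvd_power by blast
    then have "p * p dvd x\<^sup>2" by (simp add: power2_eq_square mult_dvd_mono)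
    then have "p * p dvd p * (8 * j)"
      unfolding x[symmetric] by (simp add: power2_eq_square dvd_add_right_iff mult.assoc)
    then have "p dvd 2 ^ 3 * j" using assms by simp
    then have "p dvd 2 \<or> p dvd j" using assms prime_dvd_mult_nat prime_dvd_power by blast
    then show False using j assms by (auto dest: dvd_imp_le)
  qed
  moreover have "98 * p\<^sup>2 * n + (49 * p * (p + 8 * j) + 3) div 4 = 98 * (m + p * j) + 13"
  proof -
    have "49 * p * (p + 8 * j) + 3 = 4 * (98 * tri k + 98 * p * j + 13)"
      using p2 by (simp add: power2_eq_square algebra_simps)
    then show ?thesis by (simp add: m_def algebra_simps)
  qed
  ultimately show "[b_reg 4 7 (98 * p\<^sup>2 * n + (49 * p * (p + 8 * j) + 3) div 4) = 0] (mod 2)"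
    using b47_parity_98[of "m + p * j"] by simp
qed

end
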